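(* Let $n$ be a positive integer and let $A$ and $B$ be two different subsets of $\{1,2,\ldots,n\}$ with $n\in A\cap B$ and $H(\lambda_A)=H(\lambda_B)$. Then the partitions $\lambda_A$ and $\lambda_B$ are conjugate to each other if and only if $A\setminus B$ and $B\setminus A$ are both $n$-symmetric sets, where a set $S$ is called $n$-symmetric if $S=\{n-x : x\in S\}$.
   Context: A partition is a finite weakly decreasing sequence of positive integers $\lambda=(\lambda_1,\ldots,\lambda_m)$, visualized by its Young diagram (left-justified rows, $\lambda_i$ boxes in row $i$). The hook length of a box is the number of boxes in the same row to its right, plus the number of boxes in the same column below it, plus one. The hook multiset $H(\lambda)$ is the multiset of hook lengths of all boxes of $\lambda$. The $\beta$-set of $\lambda=(\lambda_1,\ldots,\lambda_m)$ is $\beta(\lambda)=\{\lambda_i+m-i: 1\le i\le m\}$; a partition is uniquely determined by its $\beta$-set, and for a finite set $A$ of positive integers, $\lambda_A$ denotes the partition whose $\beta$-set is $A$. The conjugate of $\lambda$ is $\lambda'=(\lambda'_1,\ldots,\lambda'_{\lambda_1})$ with $\lambda'_i=\#\{j:\lambda_j\ge i\}$. *)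

theory Defs
  imports "HOL-Library.Multiset"
begin

text \<open>Rows, columns and parts are indexed from 0 throughout, so the part
  \<open>\<lambda>\<^sub>i\<close> of the usual notation is \<^term>\<open>lam ! (i - 1)\<close>.\<close>

definition is_partition :: "nat list \<Rightarrow> bool" where
  "is_partition lam \<longleftrightarrow> sorted_wrt (\<ge>) lam \<and> (\<forall>x\<in>set lam. 0 < x)"

definition young_diagram :: "nat list \<Rightarrow> (nat \<times> nat) set" where
  "young_diagram lam = {(i, j). i < length lam \<and> j < lam ! i}"

fun hook_length :: "nat list \<Rightarrow> nat \<times> nat \<Rightarrow> nat" where
  "hook_length lam (i, j) =
     card {j'. j < j' \<and> (i, j') \<in> young_diagram lam} +
     card {i'. i < i' \<and> (i', j) \<in> young_diagram lam} + 1"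

definition hook_multiset :: "nat list \<Rightarrow> nat multiset" where
  "hook_multiset lam = image_mset (hook_length lam) (mset_set (young_diagram lam))"

definition beta_set :: "nat list \<Rightarrow> nat set" where
  "beta_set lam = {lam ! i + (length lam - Suc i) | i. i < length lam}"

text \<open>Meaningful for finite sets of positive integers; existence and uniqueness
  in that case are shown below.\<close>

definition partition_of_beta :: "nat set \<Rightarrow> nat list" where
  "partition_of_beta A = (THE lam. is_partition lam \<and> beta_set lam = A)"

definition conjugate :: "nat list \<Rightarrow> nat list" where
  "conjugate lam =
     map (\<lambda>i. card {j. j < length lam \<and> Suc i \<le> lam ! j})
       [0..<(if lam = [] then 0 else lam ! 0)]"

text \<open>Truncated subtraction is harmless here: the right-hand side only contains
  numbers up to \<open>n\<close>, so the equation forces \<open>S \<subseteq> {0..n}\<close>.\<close>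

definition n_symmetric :: "nat \<Rightarrow> nat set \<Rightarrow> bool" where
  "n_symmetric n S \<longleftrightarrow> S = {n - x | x. x \<in> S}"

lemma finite_young_diagram: "finite (young_diagram lam)"
proof -
  have "young_diagram lam = (SIGMA i:{..<length lam}. {..<lam ! i})"
    by (auto simp: young_diagram_def)
  then show ?thesis by simp
qed

lemma beta_list_unique:
  assumes "is_partition lam" "beta_set lam = A"
  shows "map (\<lambda>i. lam ! i + (length lam - Suc i)) [0..<length lam]
       = rev (sorted_list_of_set A)" (is "?xs = _")
proof -
  have mono: "lam ! j \<le> lam ! i" if "i < j" "j < length lam" for i j
    using assms(1) that by (auto simp: is_partition_def sorted_wrt_iff_nth_less)
  then have dec: "?xs ! j < ?xs ! i" if "i < j" "j < length lam" for i j
  proof -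
    have "lam ! j \<le> lam ! i" using mono that .
    moreover have "length lam - Suc j < length lam - Suc i" using that by linarith
    ultimately show ?thesis using that by simp
  qed
  have "sorted_wrt (>) ?xs"
    using dec by (simp add: sorted_wrt_iff_nth_less)
  then have sw: "sorted_wrt (<) (rev ?xs)" by (simp add: sorted_wrt_rev)
  have st: "set (rev ?xs) = A"
    unfolding assms(2)[symmetric] beta_set_def set_rev set_map set_upt
    by (simp only: image_def atLeastLessThan_iff Bex_def) blast
  have "sorted_list_of_set A = rev ?xs"
    using sw st by (metis sorted_list_of_set.idem_if_sorted_distinct strict_sorted_iff)
  then show ?thesis by simp
qed

lemma partition_of_beta_ex1:
  assumes "finite A" "0 \<notin> A"
  shows "\<exists>!lam. is_partition lam \<and> beta_set lam = A"
proof -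
  define xs where "xs = rev (sorted_list_of_set A)"
  define m where "m = length xs"
  define lam where "lam = map (\<lambda>i. xs ! i - (m - Suc i)) [0..<m]"
  have len: "length lam = m" by (simp add: lam_def)
  have "sorted_wrt (>) xs" by (simp add: xs_def sorted_wrt_rev)
  then have dec: "xs ! j < xs ! i" if "i < j" "j < m" for i j
    using that by (simp add: m_def sorted_wrt_iff_nth_less)
  have set: "set xs = A" using assms by (simp add: xs_def)
  have low: "m - i \<le> xs ! i" if "i < m" for i
    using that
  proof (induction "m - i" arbitrary: i)
    case 0 then show ?case by simp
  next
    case (Suc k)
    show ?case
    proof (cases "Suc i < m")
      case True
      have "m - Suc i \<le> xs ! Suc i" using Suc True by simp
      moreover have "xs ! Suc i < xs ! i" using dec True by simp
      ultimately show ?thesis using True by linarith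
    next
      case False
      have "xs ! i \<in> A" using Suc.prems set by (auto simp: m_def)
      then have "xs ! i \<noteq> 0" using assms(2) by metis
      then show ?thesis using False Suc.prems by linarith
    qed
  qed
  have gap: "xs ! j + (j - i) \<le> xs ! i" if "i < j" "j < m" for i j
    using that
  proof (induction j)
    case 0 then show ?case by simp
  next
    case (Suc j)
    have "xs ! Suc j < xs ! j" using dec Suc.prems by simp
    then show ?case using Suc by (cases "i = j") (auto simp: Suc_diff_le)
  qed
  have "is_partition lam"
    unfolding is_partition_def
  proof (intro conjI ballI)
    show "sorted_wrt (\<ge>) lam"
      unfolding sorted_wrt_iff_nth_less len
    proof (intro allI impI)
      fix i j assume "i < j" "j < m"
      then show "lam ! i \<ge> lam ! j" using gap[of i j] by (simp add: lam_def)
    qed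
    have "0 < xs ! i - (m - Suc i)" if "i < m" for i
      using low[OF that] that by linarith
    then show "0 < x" if "x \<in> set lam" for x
      using that unfolding lam_def set_map by (elim imageE) simp
  qed
  moreover have "beta_set lam = A"
  proof -
    have "lam ! i + (length lam - Suc i) = xs ! i" if "i < m" for i
      using low[OF that] that len by (simp add: lam_def)
    then have "(\<lambda>i. lam ! i + (length lam - Suc i)) ` {..<m} = (!) xs ` {..<m}"
      by (intro image_cong) (simp_all only: lessThan_iff)
    then have "beta_set lam = {xs ! i | i. i < m}"
      by (simp only: beta_set_def len image_def lessThan_iff Bex_def conj_commute)
    also have "\<dots> = A" using set by (auto simp: m_def set_conv_nth)
    finally show ?thesis .
  qed
  moreover have "mu = nu"
    if "is_partition mu" "beta_set mu = A" "is_partition nu" "beta_set nu = A" for mu nu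
  proof -
    have eq: "map (\<lambda>i. mu ! i + (length mu - Suc i)) [0..<length mu]
        = map (\<lambda>i. nu ! i + (length nu - Suc i)) [0..<length nu]"
      using beta_list_unique that by metis
    then have l: "length mu = length nu" using map_eq_imp_length_eq by fastforce
    have "mu ! i = nu ! i" if "i < length mu" for i
      using arg_cong[OF eq, of "\<lambda>ys. ys ! i"] that l by simp
    then show ?thesis using l by (simp add: nth_equalityI)
  qed
  ultimately show ?thesis by blast
qed

lemma partition_of_beta:
  assumes "finite A" "0 \<notin> A"
  shows "is_partition (partition_of_beta A)" "beta_set (partition_of_beta A) = A"
  using theI'[OF partition_of_beta_ex1[OF assms]] by (simp_all add: partition_of_beta_def)

end

theory Submission
  imports Defs
begin

text \<open>The hook lengths of \<open>\<lambda>\<^sub>A\<close> are the positive differences \<open>a - c\<close> with \<open>a \<in> A\<close> and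
  \<open>c \<notin> A\<close>, and the \<open>\<beta>\<close>-set of its conjugate is \<open>{n - c | c \<le> n, c \<notin> A}\<close>; hence conjugacy means
  that \<open>x \<in> B\<close> iff \<open>n - x \<notin> A\<close>, which gives the forward direction at once. For the converse put
  \<open>C = A \<inter> B\<close>, \<open>D = {0..n} - (A \<union> B)\<close>, and let \<open>Z\<close> be the difference of the indicators of \<open>A\<close>
  and \<open>B\<close> and \<open>E(k) = [n - k \<in> D] - [k \<in> C]\<close>. Both \<open>Z\<close> and \<open>E\<close> are invariant
  under \<open>k \<mapsto> n - k\<close>, conjugacy means \<open>E = 0\<close>, and equality of the hook multisets says that all
  correlations \<open>\<Sum>\<^sub>x Z(x) E(x + h)\<close> with \<open>h > 0\<close> vanish. If \<open>E \<noteq> 0\<close>, let \<open>m\<close> be the least point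
  of the support of \<open>Z\<close> and \<open>e\<close> the greatest point of that of \<open>E\<close>. By symmetry
  \<open>m \<le> n/2 \<le> e\<close>. The correlation at \<open>h = e - m\<close> has the single nonzero term \<open>Z(m) E(e)\<close>, so
  \<open>m = e = n/2\<close>, which is impossible since the two supports are disjoint.\<close>

section \<open>Reflection of the common part\<close>

text \<open>Writing the count as a sum of products of indicators lets it be split algebraically
  later.\<close>

lemma card_shift_eq_sum:
  fixes A :: "nat set"
  assumes "A \<subseteq> {..n}" "h \<le> n"
  shows "int (card {x. x \<notin> A \<and> x + h \<in> A}) =
    (\<Sum>x\<le>n - h. of_bool (x + h \<in> A) * (1 - of_bool (x \<in> A)))"
proof -
  have "(\<Sum>x\<le>n - h. of_bool (x + h \<in> A) * (1 - of_bool (x \<in> A)) :: int)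
      = (\<Sum>x\<le>n - h. of_bool (x \<notin> A \<and> x + h \<in> A))"
    by (rule sum.cong) auto
  also have "\<dots> = int (card ({..n - h} \<inter> {x. x \<notin> A \<and> x + h \<in> A}))"
    by (rule sum_of_bool_eq) simp_all
  also have "{..n - h} \<inter> {x. x \<notin> A \<and> x + h \<in> A} = {x. x \<notin> A \<and> x + h \<in> A}"
    using assms by fastforce
  finally show ?thesis ..
qed

text \<open>The involution \<open>x\<close> to \<open>n - (x + h)\<close> sends \<open>x + h\<close>
  to \<open>n - x\<close>, so the symmetry of \<open>f\<close> moves the shift off \<open>f\<close>
  and onto a reflected \<open>g\<close>.\<close>

lemma sum_reflect:
  fixes f g :: "nat \<Rightarrow> int"
  assumes "h \<le> n" and "\<And>x. x \<le> n \<Longrightarrow> f (n - x) = f x"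
  shows "(\<Sum>x\<le>n - h. f (x + h) * g x) = (\<Sum>x\<le>n - h. f x * g (n - (x + h)))"
proof (rule sum.reindex_bij_witness[where i = "\<lambda>x. n - (x + h)" and j = "\<lambda>x. n - (x + h)"])
  fix x assume "x \<in> {..n - h}"
  then have x: "x + h \<le> n" using assms(1) by simp
  then show "f (n - (x + h)) * g (n - (n - (x + h) + h)) = f (x + h) * g x"
    using assms(2)[OF x] by simp
qed (use assms(1) in simp_all)

lemma n_symmetric_iff:
  assumes "S \<subseteq> {..n}"
  shows "n_symmetric n S \<longleftrightarrow> (\<forall>x\<le>n. n - x \<in> S \<longleftrightarrow> x \<in> S)"
proof
  assume S: "n_symmetric n S"
  have imp: "n - x \<in> S" if "x \<in> S" for x using S that unfolding n_symmetric_def by blast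
  show "\<forall>x\<le>n. n - x \<in> S \<longleftrightarrow> x \<in> S"
    using imp by (metis diff_diff_cancel)
next
  assume *: "\<forall>x\<le>n. n - x \<in> S \<longleftrightarrow> x \<in> S"
  have "x \<in> S \<Longrightarrow> \<exists>y. x = n - y \<and> y \<in> S" for x
    using * assms by (metis atMost_iff diff_diff_cancel subsetD)
  moreover have "x \<in> S \<Longrightarrow> n - x \<in> S" for x using * assms by blast
  ultimately show "n_symmetric n S" unfolding n_symmetric_def by blast
qed

text \<open>An extremal-term argument: the shift from the least point of the support of
  \<open>Z\<close> to the greatest point of the support of \<open>E\<close> is realised by one pair
  only, so nothing can cancel its product.\<close>

lemma correlation_vanishes:
  fixes Z E :: "nat \<Rightarrow> int"
  assumes Z: "\<And>x. x \<le> n \<Longrightarrow> Z (n - x) = Z x"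
    and E: "\<And>x. x \<le> n \<Longrightarrow> E (n - x) = E x"
    and disjoint: "\<And>x. x \<le> n \<Longrightarrow> Z x = 0 \<or> E x = 0"
    and corr: "\<And>h. \<lbrakk>0 < h; h \<le> n\<rbrakk> \<Longrightarrow> (\<Sum>x\<le>n - h. Z x * E (x + h)) = 0"
    and nz: "z \<le> n" "Z z \<noteq> 0"
    and k: "k \<le> n"
  shows "E k = 0"
proof (rule ccontr)
  assume Ek: "E k \<noteq> 0"
  define m where "m = Min {x. x \<le> n \<and> Z x \<noteq> 0}"
  define e where "e = Max {x. x \<le> n \<and> E x \<noteq> 0}"
  have "m \<in> {x. x \<le> n \<and> Z x \<noteq> 0}" unfolding m_def by (rule Min_in) (use nz in auto)
  then have m: "m \<le> n" "Z m \<noteq> 0" by simp_all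
  have "e \<in> {x. x \<le> n \<and> E x \<noteq> 0}" unfolding e_def by (rule Max_in) (use k Ek in auto)
  then have e: "e \<le> n" "E e \<noteq> 0" by simp_all
  have m_min: "m \<le> x" if "x \<le> n" "Z x \<noteq> 0" for x using that by (simp add: m_def)
  have e_max: "x \<le> e" if "x \<le> n" "E x \<noteq> 0" for x using that by (simp add: e_def)
  have "m \<le> n - m" using m_min[of "n - m"] Z[of m] m by simp
  moreover have "n - e \<le> e" using e_max[of "n - e"] E[of e] e by simp
  moreover have "m \<noteq> e" using disjoint[of m] m e by auto
  ultimately have "m < e" by linarith
  define h where "h = e - m"
  have h: "0 < h" "h \<le> n" "m + h = e" using \<open>m < e\<close> e(1) by (auto simp: h_def)
  \<comment> \<open>A nonzero term would need \<open>m \<le> x\<close> and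
    \<open>x + h \<le> e = m + h\<close>, forcing \<open>x = m\<close>.\<close>
  have "Z x * E (x + h) = 0" if "x \<in> {..n - h} - {m}" for x
  proof (cases "Z x = 0")
    case False
    have x: "x \<noteq> m" "x + h \<le> n" using that h(2) by auto
    moreover have "m \<le> x" using m_min[of x] False x by simp
    ultimately have "E (x + h) = 0" using e_max[of "x + h"] h(3) by linarith
    then show ?thesis by simp
  qed simp
  then have "(\<Sum>x\<le>n - h. Z x * E (x + h)) = (\<Sum>x\<in>{m}. Z x * E (x + h))"
    using h e(1) by (intro sum.mono_neutral_right) auto
  then show False using corr[OF h(1,2)] h(3) m e by simp
qed

text \<open>In the shift counts for \<open>A\<close> and \<open>B\<close>, the terms pairing
  \<open>C\<close> with \<open>D\<close> are equal, those pairing \<open>X\<close> with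
  \<open>Y\<close> cancel by reflection, and the rest combine into the correlation of
  \<open>Z\<close> with \<open>E\<close>.\<close>

lemma reflected_complement:
  fixes A B :: "nat set"
  assumes A: "A \<subseteq> {..n}" and B: "B \<subseteq> {..n}" and "A \<noteq> B"
    and symX: "n_symmetric n (A - B)" and symY: "n_symmetric n (B - A)"
    and shift: "\<And>h. 0 < h \<Longrightarrow>
      card {x. x \<notin> A \<and> x + h \<in> A} = card {x. x \<notin> B \<and> x + h \<in> B}"
    and "k \<le> n"
  shows "k \<in> B \<longleftrightarrow> n - k \<notin> A"
proof -
  define X Y C D :: "nat \<Rightarrow> int" where "X x = of_bool (x \<in> A - B)" and "Y x = of_bool (x \<in> B - A)"
    and "C x = of_bool (x \<in> A \<inter> B)" and "D x = of_bool (x \<notin> A \<union> B)" for x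
  note defs = X_def Y_def C_def D_def
  define Z E :: "nat \<Rightarrow> int" where "Z x = X x - Y x" and "E x = D (n - x) - C x" for x
  have memX: "n - x \<in> A - B \<longleftrightarrow> x \<in> A - B" if "x \<le> n" for x
    using symX that A n_symmetric_iff[of "A - B" n] by blast
  have memY: "n - x \<in> B - A \<longleftrightarrow> x \<in> B - A" if "x \<le> n" for x
    using symY that B n_symmetric_iff[of "B - A" n] by blast
  have X: "X (n - x) = X x" and Y: "Y (n - x) = Y x" if "x \<le> n" for x
    unfolding X_def Y_def memX[OF that] memY[OF that] by simp_all
  have Z: "Z (n - x) = Z x" if "x \<le> n" for x
    using X[OF that] Y[OF that] by (simp add: Z_def)
  have CD: "C x + D x = 1 - X x - Y x" for x
    by (cases "x \<in> A"; cases "x \<in> B") (simp_all add: defs)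
  \<comment> \<open>The difference of the two sides is \<open>C + D\<close> at \<open>x\<close>
    minus \<open>C + D\<close> at \<open>n - x\<close>, and \<open>C + D = 1 - X - Y\<close> is
    symmetric.\<close>
  have E: "E (n - x) = E x" if "x \<le> n" for x
    using X[OF that] Y[OF that] CD[of x] CD[of "n - x"] that by (simp add: E_def)
  have corr: "(\<Sum>x\<le>n - h. Z x * E (x + h)) = 0" if "0 < h" "h \<le> n" for h
  proof -
    have "0 = (\<Sum>x\<le>n - h. of_bool (x + h \<in> A) * (1 - of_bool (x \<in> A)))
        - (\<Sum>x\<le>n - h. of_bool (x + h \<in> B) * (1 - of_bool (x \<in> B)) :: int)"
      unfolding card_shift_eq_sum[OF A that(2), symmetric] card_shift_eq_sum[OF B that(2), symmetric]
        shift[OF that(1)] by simp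
    also have "\<dots> = (\<Sum>x\<le>n - h. X (x + h) * Y x - Y (x + h) * X x + Z (x + h) * D x
        - Z x * C (x + h))"
      unfolding sum_subtractf[symmetric]
    proof (rule sum.cong)
      fix x
      have "of_bool (y \<in> A) = C y + X y" "of_bool (y \<in> B) = C y + Y y" for y
        by (simp_all add: defs)
      moreover have "1 - of_bool (y \<in> A) = D y + Y y" "1 - of_bool (y \<in> B) = D y + X y" for y
        by (simp_all add: defs)
      ultimately show "of_bool (x + h \<in> A) * (1 - of_bool (x \<in> A))
          - of_bool (x + h \<in> B) * (1 - of_bool (x \<in> B))
          = X (x + h) * Y x - Y (x + h) * X x + Z (x + h) * D x - Z x * C (x + h)"
        by (simp only: Z_def) (simp add: algebra_simps)
    qed simp
    also have "\<dots> = (\<Sum>x\<le>n - h. X (x + h) * Y x) - (\<Sum>x\<le>n - h. Y (x + h) * X x)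
        + (\<Sum>x\<le>n - h. Z (x + h) * D x) - (\<Sum>x\<le>n - h. Z x * C (x + h))"
      by (simp add: sum_subtractf sum.distrib)
    also have "(\<Sum>x\<le>n - h. X (x + h) * Y x) = (\<Sum>x\<le>n - h. Y (x + h) * X x)"
    proof -
      have "(\<Sum>x\<le>n - h. X (x + h) * Y x) = (\<Sum>x\<le>n - h. X x * Y (n - (x + h)))"
        using that(2) X by (rule sum_reflect)
      also have "\<dots> = (\<Sum>x\<le>n - h. Y (x + h) * X x)"
        by (rule sum.cong) (use Y that(2) in auto)
      finally show ?thesis .
    qed
    also have "(\<Sum>x\<le>n - h. Z (x + h) * D x) = (\<Sum>x\<le>n - h. Z x * D (n - (x + h)))"
      using that(2) Z by (rule sum_reflect)
    finally show ?thesis by (simp add: E_def right_diff_distrib sum_subtractf)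
  qed
  \<comment> \<open>The symmetric difference of \<open>A\<close> and \<open>B\<close> is stable
    under reflection, so both terms of \<open>E\<close> vanish on it; off it \<open>Z\<close>
    vanishes.\<close>
  have disjoint: "Z x = 0 \<or> E x = 0" if "x \<le> n" for x
  proof (cases "x \<in> (A - B) \<union> (B - A)")
    case True
    then have "n - x \<in> (A - B) \<union> (B - A)" using memX[OF that] memY[OF that] by blast
    with True have "D (n - x) = 0" "C x = 0" unfolding C_def D_def by auto
    then show ?thesis by (simp add: E_def)
  next
    case False
    then have "x \<notin> A - B" "x \<notin> B - A" by blast+
    then show ?thesis by (simp only: Z_def X_def Y_def of_bool_eq diff_self simp_thms)
  qed
  obtain z where "z \<in> (A - B) \<union> (B - A)" using \<open>A \<noteq> B\<close> by blast
  then have "z \<le> n" "Z z \<noteq> 0" using A B by (auto simp: Z_def defs)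
  from correlation_vanishes[of n Z E, OF Z E disjoint corr this \<open>k \<le> n\<close>]
  have "E k = 0" .
  \<comment> \<open>Reflection thus exchanges common members with common non-members, while it
    preserves \<open>A - B\<close> and \<open>B - A\<close>.\<close>
  then have "n - k \<notin> A \<union> B \<longleftrightarrow> k \<in> A \<inter> B" by (auto simp: E_def C_def D_def split: if_splits)
  then show ?thesis using memX[OF \<open>k \<le> n\<close>] memY[OF \<open>k \<le> n\<close>] by blast
qed

section \<open>Gaps of the beta-set\<close>

definition col_length :: "nat list \<Rightarrow> nat \<Rightarrow> nat" where
  "col_length lam j = card {i. i < length lam \<and> j < lam ! i}"

text \<open>On the boundary path read from the bottom left, this is the position of the horizontal
  step of column \<open>j\<close>: before it come \<open>j\<close> horizontal steps and one vertical
  step for each row not reaching column \<open>j\<close>.\<close>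

definition beta_gap :: "nat list \<Rightarrow> nat \<Rightarrow> nat" where
  "beta_gap lam j = j + (length lam - col_length lam j)"

lemma beta_set_eq_image:
  "beta_set lam = (\<lambda>i. lam ! i + (length lam - Suc i)) ` {..<length lam}"
  unfolding beta_set_def by blast

lemma is_partition_nth_mono:
  assumes "is_partition lam" "i \<le> i'" "i' < length lam"
  shows "lam ! i' \<le> lam ! i"
  using assms by (cases "i = i'") (auto simp: is_partition_def sorted_wrt_iff_nth_less)

lemma down_closed_eq_lessThan_card:
  fixes S :: "nat set"
  assumes "finite S" and "\<And>x y. \<lbrakk>x \<le> y; y \<in> S\<rbrakk> \<Longrightarrow> x \<in> S"
  shows "S = {..<card S}"
proof -
  define k where "k = (LEAST k. k \<notin> S)"
  have "\<exists>k. k \<notin> S" using assms(1) by (meson ex_new_if_finite infinite_UNIV_nat)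
  then have "k \<notin> S" unfolding k_def by (rule LeastI_ex)
  moreover have "x \<in> S" if "x < k" for x
    using not_less_Least[OF that[unfolded k_def]] by simp
  ultimately have "S = {..<k}" using assms(2) by (auto simp: not_less[symmetric])
  then show ?thesis by simp
qed

lemma col_set_eq_lessThan:
  assumes "is_partition lam"
  shows "{i. i < length lam \<and> j < lam ! i} = {..<col_length lam j}"
  unfolding col_length_def
proof (rule down_closed_eq_lessThan_card)
  fix x y assume "x \<le> y" "y \<in> {i. i < length lam \<and> j < lam ! i}"
  then show "x \<in> {i. i < length lam \<and> j < lam ! i}"
    using is_partition_nth_mono[OF assms, of x y] by auto
qed simp

lemma less_col_length_iff:
  assumes "is_partition lam" "i < length lam"
  shows "i < col_length lam j \<longleftrightarrow> j < lam ! i"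
  using col_set_eq_lessThan[OF assms(1), of j] assms(2) by blast

lemma col_length_le: "col_length lam j \<le> length lam"
proof -
  have "col_length lam j \<le> card {..<length lam}"
    unfolding col_length_def by (rule card_mono) auto
  then show ?thesis by simp
qed

lemma col_length_antimono:
  assumes "j \<le> j'"
  shows "col_length lam j' \<le> col_length lam j"
  unfolding col_length_def by (rule card_mono) (use assms in auto)

lemma beta_gap_strict_mono: "strict_mono (beta_gap lam)"
  unfolding strict_mono_def beta_gap_def
proof (intro allI impI)
  fix x y :: nat assume "x < y"
  then show "x + (length lam - col_length lam x) < y + (length lam - col_length lam y)"
    using col_length_antimono[of x y lam] by linarith
qed

text \<open>The beta-number of row \<open>i\<close> minus the gap of column \<open>j\<close> is
  \<open>(lam ! i - j) + (col_length lam j - i) - 1\<close> over the integers. Both brackets are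
  positive if the box exists and neither is otherwise, so the difference is never zero.\<close>

lemma beta_gap_vs_beta:
  assumes "is_partition lam" "i < length lam"
  shows beta_gap_less_iff: "beta_gap lam j < lam ! i + (length lam - Suc i) \<longleftrightarrow> j < lam ! i"
    and beta_gap_neq: "beta_gap lam j \<noteq> lam ! i + (length lam - Suc i)"
  using less_col_length_iff[OF assms, of j] col_length_le[of lam j] assms(2)
  unfolding beta_gap_def by linarith+

lemma beta_inj:
  assumes "is_partition lam"
  shows "inj_on (\<lambda>i. lam ! i + (length lam - Suc i)) {..<length lam}"
proof (rule linorder_inj_onI)
  fix i i' assume "i < i'" "i \<in> {..<length lam}" "i' \<in> {..<length lam}"
  then show "lam ! i + (length lam - Suc i) \<noteq> lam ! i' + (length lam - Suc i')"
    using is_partition_nth_mono[OF assms, of i i'] by simp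
qed auto

text \<open>By counting: the beta-numbers below the gap of column \<open>j\<close> are those of the
  rows that miss this column, which leaves \<open>j\<close> other numbers, and the \<open>j\<close>
  earlier gaps are among them.\<close>

lemma lessThan_beta_gap_diff:
  assumes "is_partition lam"
  shows "{..<beta_gap lam j} - beta_set lam = beta_gap lam ` {..<j}"
proof (rule card_subset_eq[symmetric])
  let ?b = "\<lambda>i. lam ! i + (length lam - Suc i)"
  show "beta_gap lam ` {..<j} \<subseteq> {..<beta_gap lam j} - beta_set lam"
  proof (intro image_subsetI DiffI)
    fix x assume "x \<in> {..<j}"
    then show "beta_gap lam x \<in> {..<beta_gap lam j}"
      by (simp add: strict_mono_less[OF beta_gap_strict_mono])
    show "beta_gap lam x \<notin> beta_set lam"
      using beta_gap_neq[OF assms] unfolding beta_set_eq_image by blast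
  qed
  have "{..<beta_gap lam j} \<inter> beta_set lam = ?b ` {col_length lam j..<length lam}"
  proof -
    have "?b i < beta_gap lam j \<longleftrightarrow> col_length lam j \<le> i" if "i < length lam" for i
      using beta_gap_vs_beta[OF assms that, of j] less_col_length_iff[OF assms that, of j]
      by linarith
    then have "{i \<in> {..<length lam}. ?b i < beta_gap lam j} = {col_length lam j..<length lam}"
      by auto
    moreover have "{..<beta_gap lam j} \<inter> beta_set lam
        = ?b ` {i \<in> {..<length lam}. ?b i < beta_gap lam j}"
      unfolding beta_set_eq_image by blast
    ultimately show ?thesis by simp
  qed
  moreover have "inj_on ?b {col_length lam j..<length lam}"
    by (rule inj_on_subset[OF beta_inj[OF assms]]) auto
  ultimately have "card ({..<beta_gap lam j} \<inter> beta_set lam) = length lam - col_length lam j"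
    by (simp only: card_image card_atLeastLessThan)
  then have "card ({..<beta_gap lam j} - beta_set lam) = j"
    by (simp add: card_Diff_subset_Int beta_gap_def)
  then show "card (beta_gap lam ` {..<j}) = card ({..<beta_gap lam j} - beta_set lam)"
    by (simp add: card_image inj_on_def strict_mono_eq[OF beta_gap_strict_mono])
qed simp

lemma range_beta_gap:
  assumes "is_partition lam"
  shows "range (beta_gap lam) = - beta_set lam"
proof (intro equalityI subsetI)
  fix c assume "c \<in> range (beta_gap lam)"
  then obtain j where "c = beta_gap lam j" by blast
  then show "c \<in> - beta_set lam"
    using lessThan_beta_gap_diff[OF assms, of "Suc j"] by blast
next
  fix c assume "c \<in> - beta_set lam"
  \<comment> \<open>Column \<open>j\<close> has a gap of at least \<open>j\<close>, so looking below
    the gap of column \<open>Suc c\<close> is enough to catch \<open>c\<close>.\<close>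
  moreover have "c < beta_gap lam (Suc c)" by (simp add: beta_gap_def)
  ultimately show "c \<in> range (beta_gap lam)"
    using lessThan_beta_gap_diff[OF assms, of "Suc c"] by blast
qed

section \<open>Hook lengths and the conjugate in terms of the beta-set\<close>

text \<open>The arm is \<open>lam ! i - Suc j\<close> and the leg
  \<open>col_length lam j - Suc i\<close>; their sum plus one is the beta-number of the row minus
  the gap of the column.\<close>

lemma hook_length_add_beta_gap:
  assumes "is_partition lam" "(i, j) \<in> young_diagram lam"
  shows "hook_length lam (i, j) + beta_gap lam j = lam ! i + (length lam - Suc i)"
proof -
  have ij: "i < length lam" "j < lam ! i" using assms(2) by (auto simp: young_diagram_def)
  have "{j'. j < j' \<and> (i, j') \<in> young_diagram lam} = {j<..<lam ! i}"
    using ij by (auto simp: young_diagram_def)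
  moreover have "{i'. i < i' \<and> (i', j) \<in> young_diagram lam} = {i<..<col_length lam j}"
  proof -
    have "{i'. i < i' \<and> (i', j) \<in> young_diagram lam}
        = {i'. i' < length lam \<and> j < lam ! i'} \<inter> {i<..}"
      by (auto simp: young_diagram_def)
    also have "\<dots> = {i<..<col_length lam j}"
      unfolding col_set_eq_lessThan[OF assms(1)] by auto
    finally show ?thesis .
  qed
  ultimately have "hook_length lam (i, j) = (lam ! i - Suc j) + (col_length lam j - Suc i) + 1"
    by simp
  moreover have "i < col_length lam j" using less_col_length_iff[OF assms(1) ij(1)] ij(2) by simp
  \<comment> \<open>The slacks \<open>a\<close>, \<open>b\<close> and \<open>c\<close> eliminate
    every truncated subtraction.\<close>
  then obtain b where "col_length lam j = Suc i + b" using less_iff_Suc_add by auto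
  moreover obtain c where "length lam = col_length lam j + c"
    using le_Suc_ex[OF col_length_le[of lam j]] by blast
  moreover obtain a where "lam ! i = Suc j + a" using ij(2) less_iff_Suc_add by auto
  ultimately show ?thesis by (simp add: beta_gap_def del: hook_length.simps)
qed

declare hook_length.simps [simp del]

text \<open>A box of hook length \<open>h\<close> is encoded by the gap \<open>x\<close> of its
  column; its row is recovered from the beta-number \<open>x + h\<close>.\<close>

lemma count_hook_multiset:
  assumes "is_partition lam" "0 < h"
  shows "count (hook_multiset lam) h = card {x. x \<notin> beta_set lam \<and> x + h \<in> beta_set lam}"
proof -
  let ?S = "{p \<in> young_diagram lam. hook_length lam p = h}"
  let ?T = "{x. x \<notin> beta_set lam \<and> x + h \<in> beta_set lam}"
  have inj: "beta_gap lam j = beta_gap lam j' \<longleftrightarrow> j = j'" for j j'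
    by (rule strict_mono_eq[OF beta_gap_strict_mono])
  have gap: "hook_length lam (i, j) = h \<longleftrightarrow>
      beta_gap lam j + h = lam ! i + (length lam - Suc i)"
    if "(i, j) \<in> young_diagram lam" for i j
    using hook_length_add_beta_gap[OF assms(1) that] by linarith
  have "bij_betw (\<lambda>(i, j). beta_gap lam j) ?S ?T"
    unfolding bij_betw_def
  proof (intro conjI equalityI subsetI)
    show "inj_on (\<lambda>(i, j). beta_gap lam j) ?S"
    proof (rule inj_onI)
      fix p q
      assume "p \<in> ?S" "q \<in> ?S" "(\<lambda>(i, j). beta_gap lam j) p = (\<lambda>(i, j). beta_gap lam j) q"
      moreover obtain i j i' j' where pq: "p = (i, j)" "q = (i', j')" by fastforce
      ultimately have *: "(i, j) \<in> young_diagram lam" "(i', j') \<in> young_diagram lam"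
        "hook_length lam (i, j) = h" "hook_length lam (i', j') = h"
        "beta_gap lam j = beta_gap lam j'"
        by simp_all
      then have "lam ! i + (length lam - Suc i) = lam ! i' + (length lam - Suc i')"
        using gap[of i j] gap[of i' j'] by (simp only:)
      moreover have "i \<in> {..<length lam}" "i' \<in> {..<length lam}"
        using *(1,2) by (simp_all add: young_diagram_def)
      ultimately have "i = i'" by (rule inj_onD[OF beta_inj[OF assms(1)]])
      then show "p = q" using *(5) inj pq by simp
    qed
  next
    fix x assume "x \<in> (\<lambda>(i, j). beta_gap lam j) ` ?S"
    then obtain i j where ij: "(i, j) \<in> young_diagram lam" "hook_length lam (i, j) = h"
      "x = beta_gap lam j" by auto
    have "x \<notin> beta_set lam" using range_beta_gap[OF assms(1)] ij(3) by blast
    moreover have "x + h \<in> beta_set lam"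
      using gap[OF ij(1)] ij unfolding beta_set_eq_image young_diagram_def by blast
    ultimately show "x \<in> ?T" by simp
  next
    fix x assume x: "x \<in> ?T"
    then obtain j where j: "x = beta_gap lam j" using range_beta_gap[OF assms(1)] by blast
    obtain i where i: "i < length lam" "x + h = lam ! i + (length lam - Suc i)"
      using x unfolding beta_set_def by blast
    \<comment> \<open>Since \<open>h\<close> is positive, the gap lies below the beta-number, which
      means that row \<open>i\<close> reaches column \<open>j\<close>.\<close>
    have "j < lam ! i" using beta_gap_less_iff[OF assms(1) i(1), of j] i(2) j assms(2) by linarith
    then have ij: "(i, j) \<in> young_diagram lam" using i(1) by (simp add: young_diagram_def)
    then have "(i, j) \<in> ?S" using gap[OF ij] i(2) j by simp
    then show "x \<in> (\<lambda>(i, j). beta_gap lam j) ` ?S" using j by force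
  qed
  then have "card ?S = card ?T" by (rule bij_betw_same_card)
  moreover have "count (hook_multiset lam) h = card ?S"
    by (simp add: hook_multiset_def count_image_mset finite_young_diagram vimage_def
        Int_def conj_commute)
  ultimately show ?thesis by simp
qed

lemma conjugate_nth:
  assumes "i < length (conjugate lam)"
  shows "conjugate lam ! i = col_length lam i"
  using assms by (auto simp: conjugate_def col_length_def Suc_le_eq)

lemma length_conjugate: "lam \<noteq> [] \<Longrightarrow> length (conjugate lam) = lam ! 0"
  by (simp add: conjugate_def)

lemma is_partition_conjugate:
  assumes "is_partition lam"
  shows "is_partition (conjugate lam)"
proof (cases "lam = []")
  case True
  then show ?thesis by (simp add: conjugate_def is_partition_def)
next
  case False
  then have "0 < conjugate lam ! i" if "i < length (conjugate lam)" for i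
    using less_col_length_iff[OF assms, of 0 i] that
    by (simp add: conjugate_nth length_conjugate)
  moreover have "conjugate lam ! i' \<le> conjugate lam ! i"
    if "i < i'" "i' < length (conjugate lam)" for i i'
    using that col_length_antimono[of i i' lam] by (simp add: conjugate_nth)
  ultimately show ?thesis
    by (auto simp: is_partition_def sorted_wrt_iff_nth_less in_set_conv_nth)
qed

lemma Max_beta_set:
  assumes "is_partition lam" "lam \<noteq> []"
  shows "Max (beta_set lam) = lam ! 0 + (length lam - 1)"
proof (rule Max_eqI)
  show "finite (beta_set lam)" by (simp add: beta_set_def)
  show "lam ! 0 + (length lam - 1) \<in> beta_set lam"
    using assms(2) by (force simp: beta_set_def)
  fix y assume "y \<in> beta_set lam"
  then obtain i where "i < length lam" "y = lam ! i + (length lam - Suc i)"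
    by (auto simp: beta_set_def)
  then show "y \<le> lam ! 0 + (length lam - 1)"
    using is_partition_nth_mono[OF assms(1), of 0 i] by simp
qed

text \<open>Row \<open>i\<close> of the conjugate is column \<open>i\<close> of \<open>lam\<close>,
  and its beta-number is \<open>n\<close> minus the gap of that column.\<close>

lemma beta_set_conjugate:
  assumes "is_partition lam" "lam \<noteq> []"
  defines "n \<equiv> Max (beta_set lam)"
  shows "beta_set (conjugate lam) = (\<lambda>c. n - c) ` ({..n} - beta_set lam)"
proof -
  have n: "n = lam ! 0 + (length lam - 1)" unfolding n_def by (rule Max_beta_set[OF assms(1,2)])
  have "col_length lam (lam ! 0) = 0"
    using less_col_length_iff[OF assms(1), of 0 "lam ! 0"] assms(2) by simp
  \<comment> \<open>Column \<open>lam ! 0\<close> is the first empty one; its gap is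
    \<open>n + 1\<close>, so the gaps of the nonempty columns are all the missing numbers up to
    \<open>n\<close>.\<close>
  then have "beta_gap lam (lam ! 0) = Suc n"
    using assms(2) n by (simp add: beta_gap_def Suc_diff_Suc)
  then have gaps: "beta_gap lam ` {..<lam ! 0} = {..n} - beta_set lam"
    using lessThan_beta_gap_diff[OF assms(1), of "lam ! 0"] by (simp add: lessThan_Suc_atMost)
  have "col_length lam i + (lam ! 0 - Suc i) = n - beta_gap lam i" if i: "i < lam ! 0" for i
  proof -
    obtain a where "lam ! 0 = Suc i + a" using i less_iff_Suc_add by auto
    moreover obtain b where "length lam = col_length lam i + b"
      using le_Suc_ex[OF col_length_le[of lam i]] by blast
    moreover have "0 < col_length lam i"
      using less_col_length_iff[OF assms(1), of 0 i] assms(2) i by simp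
    ultimately show ?thesis by (simp add: n beta_gap_def)
  qed
  then have "(\<lambda>i. col_length lam i + (lam ! 0 - Suc i)) ` {..<lam ! 0}
      = (\<lambda>i. n - beta_gap lam i) ` {..<lam ! 0}"
    by (intro image_cong) (simp_all only: lessThan_iff)
  moreover have "beta_set (conjugate lam)
      = (\<lambda>i. conjugate lam ! i + (lam ! 0 - Suc i)) ` {..<lam ! 0}"
    by (simp only: beta_set_eq_image length_conjugate[OF assms(2)])
  moreover have "\<dots> = (\<lambda>i. col_length lam i + (lam ! 0 - Suc i)) ` {..<lam ! 0}"
    using assms(2) by (intro image_cong) (simp_all add: length_conjugate conjugate_nth)
  ultimately have "beta_set (conjugate lam) = (\<lambda>i. n - beta_gap lam i) ` {..<lam ! 0}" by simp
  then show ?thesis by (simp add: gaps[symmetric] image_image)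
qed

section \<open>Partitions and their beta-sets: uniqueness and existence\<close>

lemma beta_set_inject:
  assumes "is_partition lam" "is_partition mu"
  shows "beta_set lam = beta_set mu \<longleftrightarrow> lam = mu"
proof
  assume "beta_set lam = beta_set mu"
  then have eq: "map (\<lambda>i. lam ! i + (length lam - Suc i)) [0..<length lam]
      = map (\<lambda>i. mu ! i + (length mu - Suc i)) [0..<length mu]"
    using beta_list_unique[OF assms(1) refl] beta_list_unique[OF assms(2) refl] by simp
  then have len: "length lam = length mu" using map_eq_imp_length_eq by fastforce
  then have "lam ! i = mu ! i" if "i < length lam" for i
    using arg_cong[OF eq, of "\<lambda>ys. ys ! i"] that by simp
  with len show "lam = mu" by (rule nth_equalityI)
qed simp

text \<open>A beta-number depends only on the row and the number of rows below it, so a new top row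
  leaves the others unchanged.\<close>

lemma beta_set_Cons: "beta_set (k # lam) = insert (k + length lam) (beta_set lam)"
  by (simp add: beta_set_eq_image lessThan_Suc_eq_insert_0 image_image)

text \<open>A new maximum \<open>b\<close> is realised by a new top row of length
  \<open>b - length lam\<close>. It is at least as long as the old rows because \<open>b\<close>
  exceeds their beta-numbers; for empty \<open>lam\<close> it is positive because 0 is
  excluded.\<close>

lemma ex_partition_beta_set:
  assumes "finite A" "0 \<notin> A"
  shows "\<exists>lam. is_partition lam \<and> beta_set lam = A"
  using assms
proof (induction A rule: finite_linorder_max_induct)
  case empty
  have "is_partition [] \<and> beta_set [] = {}" by (simp add: is_partition_def beta_set_def)
  then show ?case ..
next
  case (insert b A)
  then obtain lam where lam: "is_partition lam" "beta_set lam = A" by auto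
  have bound: "y + length lam \<le> b \<and> 0 < y" if y: "y \<in> set lam" for y
  proof -
    obtain i where i: "i < length lam" "y = lam ! i" using y by (auto simp: in_set_conv_nth)
    have "lam ! 0 + (length lam - Suc 0) \<in> A"
      unfolding lam(2)[symmetric] beta_set_eq_image using i(1) by (intro imageI) auto
    then have "lam ! 0 + (length lam - Suc 0) < b" using insert.hyps(2) by blast
    moreover have "y \<le> lam ! 0" using is_partition_nth_mono[OF lam(1), of 0 i] i by simp
    moreover have "0 < y" using lam(1) y by (simp add: is_partition_def)
    ultimately show ?thesis by linarith
  qed
  have "length lam < b"
  proof (cases "lam = []")
    case True
    then show ?thesis using insert.prems by auto
  next
    case False
    then show ?thesis using bound[of "hd lam"] by simp
  qed
  moreover have "y \<le> b - length lam" if "y \<in> set lam" for y using bound[OF that] by linarith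
  ultimately have "is_partition ((b - length lam) # lam)"
    "beta_set ((b - length lam) # lam) = insert b A"
    using lam by (simp_all add: is_partition_def beta_set_Cons)
  then show ?case by blast
qed

lemma is_partition_beta_set_partition_of_beta:
  assumes "finite A" "0 \<notin> A"
  shows "is_partition (partition_of_beta A) \<and> beta_set (partition_of_beta A) = A"
  unfolding partition_of_beta_def
  by (rule theI') (use ex_partition_beta_set[OF assms] beta_set_inject in metis)

text \<open>Comparing beta-sets turns conjugacy into a pointwise reflection condition; the bound on
  \<open>beta_set mu\<close> lets it be tested on \<open>x \<le> n\<close> alone.\<close>

lemma conjugate_eq_iff:
  assumes "is_partition lam" "lam \<noteq> []" "Max (beta_set lam) = n"
    and "is_partition mu" "beta_set mu \<subseteq> {..n}"
  shows "conjugate lam = mu \<longleftrightarrow> (\<forall>x\<le>n. x \<in> beta_set mu \<longleftrightarrow> n - x \<notin> beta_set lam)"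
proof -
  have "(\<lambda>c. n - c) ` ({..n} - beta_set lam) = {x. x \<le> n \<and> n - x \<notin> beta_set lam}"
  proof (intro equalityI subsetI)
    fix x assume "x \<in> {x. x \<le> n \<and> n - x \<notin> beta_set lam}"
    then show "x \<in> (\<lambda>c. n - c) ` ({..n} - beta_set lam)"
      by (intro image_eqI[of _ _ "n - x"]) auto
  qed auto
  then have "beta_set (conjugate lam) = {x. x \<le> n \<and> n - x \<notin> beta_set lam}"
    using beta_set_conjugate[OF assms(1,2)] assms(3) by simp
  then have "conjugate lam = mu \<longleftrightarrow> beta_set mu = {x. x \<le> n \<and> n - x \<notin> beta_set lam}"
    using beta_set_inject[OF is_partition_conjugate[OF assms(1)] assms(4)] by auto
  also have "\<dots> \<longleftrightarrow> (\<forall>x\<le>n. x \<in> beta_set mu \<longleftrightarrow> n - x \<notin> beta_set lam)"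
    using assms(5) by auto
  finally show ?thesis .
qed

theorem theorem1:
  fixes n :: nat and A B :: "nat set"
  assumes "0 < n"
    and "A \<subseteq> {1..n}" and "B \<subseteq> {1..n}"
    and "A \<noteq> B"
    and "n \<in> A \<inter> B"
    and "hook_multiset (partition_of_beta A) = hook_multiset (partition_of_beta B)"
  shows "conjugate (partition_of_beta A) = partition_of_beta B \<longleftrightarrow>
         n_symmetric n (A - B) \<and> n_symmetric n (B - A)"
proof -
  define lam mu where "lam = partition_of_beta A" and "mu = partition_of_beta B"
  have A: "A \<subseteq> {..n}" "finite A" "0 \<notin> A" and B: "B \<subseteq> {..n}" "finite B" "0 \<notin> B"
    using assms(2,3) by (auto intro: finite_subset)
  have lam: "is_partition lam" "beta_set lam = A" and mu: "is_partition mu" "beta_set mu = B"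
    unfolding lam_def mu_def using is_partition_beta_set_partition_of_beta A B by blast+
  have shift: "card {x. x \<notin> A \<and> x + h \<in> A} = card {x. x \<notin> B \<and> x + h \<in> B}" if "0 < h" for h
    using count_hook_multiset[OF lam(1) that] count_hook_multiset[OF mu(1) that] assms(6)
    by (simp add: lam(2) mu(2) flip: lam_def mu_def)
  have AB: "A - B \<subseteq> {..n}" "B - A \<subseteq> {..n}" using A B by auto
  have "(\<forall>x\<le>n. x \<in> B \<longleftrightarrow> n - x \<notin> A) \<longleftrightarrow> n_symmetric n (A - B) \<and> n_symmetric n (B - A)"
  proof
    assume *: "\<forall>x\<le>n. x \<in> B \<longleftrightarrow> n - x \<notin> A"
    \<comment> \<open>With both forms, reflection exchanges \<open>A\<close> with the complement of
      \<open>B\<close> and \<open>B\<close> with the complement of \<open>A\<close>, hence preserves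
      \<open>A - B\<close> and \<open>B - A\<close>.\<close>
    have **: "n - x \<in> B \<longleftrightarrow> x \<notin> A" if "x \<le> n" for x
      using *[rule_format, of "n - x"] that by simp
    show "n_symmetric n (A - B) \<and> n_symmetric n (B - A)"
      unfolding n_symmetric_iff[OF AB(1)] n_symmetric_iff[OF AB(2)] using * ** by auto
  next
    assume "n_symmetric n (A - B) \<and> n_symmetric n (B - A)"
    then show "\<forall>x\<le>n. x \<in> B \<longleftrightarrow> n - x \<notin> A"
      using reflected_complement[OF A(1) B(1) assms(4) _ _ shift] by blast
  qed
  moreover have "lam \<noteq> []" using assms(5) lam(2) by (auto simp: beta_set_def)
  moreover have "Max A = n" using A assms(5) by (intro Max_eqI) auto
  ultimately show ?thesis
    using conjugate_eq_iff[of lam n mu] lam mu B(1) by (simp flip: lam_def mu_def)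
qed

end
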